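(* Let $F$ be a countable field and $E$ a countably infinite-dimensional $F$-vector space with fixed basis $(e_n)_{n\in\omega}$. There are no analytic full mad families of subspaces of $E$; that is, no full mad family $\mathcal{A}$ of infinite-dimensional subspaces of $E$ is analytic as a subset of $2^E$.
   Context: $F$ is a countable (possibly finite) field, $E$ is a vector space over $F$ of countably infinite dimension, and $(e_n)_{n\in\omega}$ is a fixed $F$-basis of $E$. For $x\in E$, $\mathrm{supp}(x)$ is the (finite) set of $n\in\omega$ such that $e_n$ has nonzero coefficient in the expansion of $x$. For nonzero $x,y\in E$, write $x<y$ if $\max(\mathrm{supp}(x))<\min(\mathrm{supp}(y))$. A block sequence is a sequence $(x_n)$ of nonzero vectors with $x_n<x_{n+1}$ for all $n$. $\langle\cdot\rangle$ denotes linear span. $\mathrm{bb}^\infty(E)$ is the set of all infinite block sequences in $E$. For $X,Y\in\mathrm{bb}^\infty(E)$, $X\preceq Y$ means $\langle X\rangle\subseteq\langle Y\rangle$. For $\mathcal{H}\subseteq\mathrm{bb}^\infty(E)$ and $X\in\mathcal{H}$, $\mathcal{H}\restriction X=\{Y\in\mathcal{H}:Y\preceq X\}$. Two infinite-dimensional subspaces $X,Y$ of $E$ are almost disjoint if $X\cap Y$ is finite-dimensional. An almost disjoint family of subspaces is a set of pairwise almost disjoint infinite-dimensional subspaces (not necessarily spanned by block sequences); it is a mad family of subspaces if it is not properly contained in another such family. For an infinite almost disjoint family $\mathcal{A}$ of subspaces, $\mathcal{H}(\mathcal{A})=\{X\in\mathrm{bb}^\infty(E):\text{there are infinitely many }Y\in\mathcal{A}\text{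 with }\dim(\langle X\rangle\cap Y)=\infty\}$. A set $\mathcal{H}\subseteq\mathrm{bb}^\infty(E)$ is full if whenever $D\subseteq E$ (not necessarily a subspace) and $X\in\mathcal{H}$ are such that for every $Y\in\mathcal{H}\restriction X$ there is a $Z\in\mathrm{bb}^\infty(E)$ with $Z\preceq Y$ and $\langle Z\rangle\subseteq D$, then there is a $Z\in\mathcal{H}\restriction X$ with $\langle Z\rangle\subseteq D$. An infinite mad family $\mathcal{A}$ of subspaces is full if $\mathcal{H}(\mathcal{A})$ is full (so full mad families are infinite by definition). Families of subspaces are regarded as subsets of the product space $2^E$ via characteristic functions; a set is analytic if it is a continuous image of a Borel set. *)

theory Defs
  imports "HOL-Analysis.Analysis"
begin

(* A continuous image of a Borel subset of a Polish space. A Polish space has at most continuum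
   many points, so letting P range over all Polish topologies whose underlying set is a set of
   reals (with no relation to the usual topology of the reals) covers all of them up to
   homeomorphism. *)
definition analytic_in :: "'a topology \<Rightarrow> 'a set \<Rightarrow> bool" where
  "analytic_in T A \<longleftrightarrow>
    (\<exists>(P :: real topology) B f.
       completely_metrizable_space P \<and> second_countable P \<and>
       B \<in> sigma_sets (topspace P) {U. openin P U} \<and>
       continuous_map (subtopology P B) T f \<and> f ` B = A)"

(* The space 2^E, for E the universe of the type 'e. *)
definition cantor_cube :: "('e \<Rightarrow> bool) topology" where
  "cantor_cube = product_topology (\<lambda>_. discrete_topology UNIV) UNIV"

definition analytic_family :: "'e set set \<Rightarrow> bool" where
  "analytic_family \<A> \<longleftrightarrow> analytic_in cantor_cube ((\<lambda>Y x. x \<in> Y) ` \<A>)"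

locale based_vector_space = vector_space scale
  for scale :: "'f::field \<Rightarrow> 'e::ab_group_add \<Rightarrow> 'e" (infixr "*s" 75) +
  fixes e :: "nat \<Rightarrow> 'e"
  assumes countable_field: "countable (UNIV :: 'f set)"
    and inj_basis: "inj e"
    and independent_basis: "independent (range e)"
    and span_basis: "span (range e) = UNIV"
begin

definition supp :: "'e \<Rightarrow> nat set" where
  "supp x = {n. representation (range e) x (e n) \<noteq> 0}"

(* Only meaningful for nonzero vectors, whose supports are nonempty. *)
definition block_less :: "'e \<Rightarrow> 'e \<Rightarrow> bool" where
  "block_less x y \<longleftrightarrow> Max (supp x) < Min (supp y)"

definition bb :: "(nat \<Rightarrow> 'e) set" where
  "bb = {X. (\<forall>n. X n \<noteq> 0) \<and> (\<forall>n. block_less (X n) (X (Suc n)))}"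

definition seq_span :: "(nat \<Rightarrow> 'e) \<Rightarrow> 'e set" where
  "seq_span X = span (range X)"

definition preceq :: "(nat \<Rightarrow> 'e) \<Rightarrow> (nat \<Rightarrow> 'e) \<Rightarrow> bool" (infix "\<preceq>" 50) where
  "X \<preceq> Y \<longleftrightarrow> seq_span X \<subseteq> seq_span Y"

definition restrict_below :: "(nat \<Rightarrow> 'e) set \<Rightarrow> (nat \<Rightarrow> 'e) \<Rightarrow> (nat \<Rightarrow> 'e) set" where
  "restrict_below H X = {Y \<in> H. Y \<preceq> X}"

(* The library's dim is a natural number, with value 0 on infinite-dimensional subspaces, so it
   cannot express finite-dimensionality. *)
definition finite_dim :: "'e set \<Rightarrow> bool" where
  "finite_dim S \<longleftrightarrow> (\<exists>B. finite B \<and> independent B \<and> span B = S)"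

definition infinite_dim_subspace :: "'e set \<Rightarrow> bool" where
  "infinite_dim_subspace S \<longleftrightarrow> subspace S \<and> \<not> finite_dim S"

definition almost_disjoint :: "'e set \<Rightarrow> 'e set \<Rightarrow> bool" where
  "almost_disjoint X Y \<longleftrightarrow> finite_dim (X \<inter> Y)"

definition ad_family :: "'e set set \<Rightarrow> bool" where
  "ad_family \<A> \<longleftrightarrow> (\<forall>Y\<in>\<A>. infinite_dim_subspace Y) \<and> pairwise almost_disjoint \<A>"

definition mad_family :: "'e set set \<Rightarrow> bool" where
  "mad_family \<A> \<longleftrightarrow> ad_family \<A> \<and> \<not> (\<exists>\<B>. ad_family \<B> \<and> \<A> \<subset> \<B>)"

definition H_of :: "'e set set \<Rightarrow> (nat \<Rightarrow> 'e) set" where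
  "H_of \<A> = {X \<in> bb. infinite {Y \<in> \<A>. \<not> finite_dim (seq_span X \<inter> Y)}}"

(* D is an arbitrary set of vectors, not necessarily a subspace. *)
definition full :: "(nat \<Rightarrow> 'e) set \<Rightarrow> bool" where
  "full H \<longleftrightarrow> H \<subseteq> bb \<and>
    (\<forall>(D :: 'e set) X. X \<in> H \<longrightarrow>
       (\<forall>Y \<in> restrict_below H X. \<exists>Z \<in> bb. Z \<preceq> Y \<and> seq_span Z \<subseteq> D) \<longrightarrow>
       (\<exists>Z \<in> restrict_below H X. seq_span Z \<subseteq> D))"

definition full_mad_family :: "'e set set \<Rightarrow> bool" where
  "full_mad_family \<A> \<longleftrightarrow> infinite \<A> \<and> mad_family \<A> \<and> full (H_of \<A>)"

end

end

(*
  Write the family as the values of a relation R between points of Baire space and subspaces that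
  is closed under limits. A pair of finite sequences s (of naturals) and vs (of vectors) determines
  the cell of those members that contain vs and have a code extending s. A cell is negligible for X
  if all its members meet the span of X in finite dimension.

  By maximality, H(A) is closed under almost-decreasing countable intersections, so (there being
  only countably many cells) some X1 in H(A) decides for every cell whether it is hereditarily
  non-negligible. Fullness, applied to the set D of vectors v such that all one-step extensions of a
  non-negligible cell by v are negligible, gives X below X1 such that every block sequence below X
  spans a vector that extends the cell to a non-negligible one: a Z in H(A) with span in D would
  meet some member of the cell in a nonzero vector of D.

  Two distinct members A0 and A1 meet X in infinite dimension. Choosing the extending vectors
  alternately in A0 and A1 yields a branch, whose limit is a member of the family that meets both
  A0 and A1 in infinite dimension, contradicting almost disjointness.
*)
theory Submission
  imports Defs
begin

section \<open>Borel sets as images of closed subsets of Baire space\<close>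


text \<open>When \<open>T\<close> is Hausdorff, such an \<open>R\<close> is the graph of a continuous function on a closed subset
  of Baire space, where convergence is pointwise.\<close>

definition baire_closed :: "'a topology \<Rightarrow> ((nat \<Rightarrow> nat) \<Rightarrow> 'a \<Rightarrow> bool) \<Rightarrow> bool" where
  "baire_closed T R \<longleftrightarrow> (\<forall>as a xs.
     (\<forall>k. R (as k) (xs k)) \<longrightarrow> (\<forall>i. \<forall>\<^sub>F k in sequentially. as k i = a i) \<longrightarrow>
     (\<exists>x. R a x \<and> limitin T xs x sequentially))"

definition baire_image :: "'a topology \<Rightarrow> 'a set \<Rightarrow> bool" where
  "baire_image T B \<longleftrightarrow> (\<exists>R. (\<forall>x. x \<in> B \<longleftrightarrow> (\<exists>a. R a x)) \<and> baire_closed T R)"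

lemma baire_closedD:
  assumes "baire_closed T R" "\<And>k. R (as k) (xs k)"
    "\<And>i. \<forall>\<^sub>F k in sequentially. as k i = a i"
  shows "\<exists>x. R a x \<and> limitin T xs x sequentially"
  using assms unfolding baire_closed_def by blast

text \<open>Coordinate 0 of a code names the set of the union; the remaining coordinates code the
  point inside it.\<close>

lemma baire_image_UN:
  assumes "\<And>n::nat. baire_image T (B n)"
  shows "baire_image T (\<Union>n. B n)"
proof -
  obtain R where R: "\<And>n x. x \<in> B n \<longleftrightarrow> (\<exists>a. R n a x)" and cl: "\<And>n. baire_closed T (R n)"
    using assms unfolding baire_image_def by metis
  define S where "S a x \<longleftrightarrow> R (a 0) (\<lambda>i. a (Suc i)) x" for a :: "nat \<Rightarrow> nat" and x
  have "x \<in> (\<Union>n. B n) \<longleftrightarrow> (\<exists>a. S a x)" for x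
  proof
    assume "x \<in> (\<Union>n. B n)"
    then obtain n a where "R n a x" using R by auto
    then have "S (case_nat n a) x" by (simp add: S_def)
    then show "\<exists>a. S a x" by blast
  qed (use R S_def in auto)
  moreover have "baire_closed T S"
    unfolding baire_closed_def
  proof (intro allI impI)
    fix as a xs
    assume S: "\<forall>k. S (as k) (xs k)" and conv: "\<forall>i. \<forall>\<^sub>F k in sequentially. as k i = a i"
    \<comment> \<open>Coordinate 0 is eventually constant, so from \<open>K\<close> on all points
      are coded by the same \<open>R (a 0)\<close>; dropping \<open>K\<close> terms does not change
      the limit.\<close>
    obtain K where K: "\<forall>k\<ge>K. as k 0 = a 0"
      using conv by (auto simp: eventually_sequentially)
    have "\<exists>x. R (a 0) (\<lambda>i. a (Suc i)) x \<and> limitin T (\<lambda>k. xs (k + K)) x sequentially"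
    proof (rule baire_closedD[OF cl])
      show "R (a 0) (\<lambda>i. as (k + K) (Suc i)) (xs (k + K))" for k
        using S K[rule_format, of "k + K"] by (simp add: S_def) (metis)
      show "\<forall>\<^sub>F k in sequentially. as (k + K) (Suc i) = a (Suc i)" for i
        using conv[rule_format, of "Suc i"]
        by (subst eventually_sequentially_seg[of "\<lambda>k. as k (Suc i) = a (Suc i)"])
    qed
    then show "\<exists>x. S a x \<and> limitin T xs x sequentially"
      unfolding S_def by (auto intro: limitin_sequentially_offset_rev)
  qed
  ultimately show ?thesis unfolding baire_image_def by blast
qed

text \<open>A code packs one code of the same point for each \<open>n\<close>. Each of these yields
  a limit of the points, and the Hausdorff property makes the limits agree.\<close>

lemma baire_image_INT:
  assumes T: "Hausdorff_space T" and "\<And>n::nat. baire_image T (B n)"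
  shows "baire_image T (\<Inter>n. B n)"
proof -
  obtain R where R: "\<And>n x. x \<in> B n \<longleftrightarrow> (\<exists>a. R n a x)" and cl: "\<And>n. baire_closed T (R n)"
    using assms(2) unfolding baire_image_def by metis
  define S where "S a x \<longleftrightarrow> (\<forall>n. R n (\<lambda>i. a (prod_encode (n, i))) x)" for a :: "nat \<Rightarrow> nat" and x
  have "x \<in> (\<Inter>n. B n) \<longleftrightarrow> (\<exists>a. S a x)" for x
  proof
    assume "x \<in> (\<Inter>n. B n)"
    then obtain f where "\<And>n. R n (f n) x" using R by simp metis
    then have "S (\<lambda>m. case prod_decode m of (n, i) \<Rightarrow> f n i) x" by (simp add: S_def)
    then show "\<exists>a. S a x" by blast
  qed (use R S_def in auto)
  moreover have "baire_closed T S"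
    unfolding baire_closed_def
  proof (intro allI impI)
    fix as a xs
    assume S: "\<forall>k. S (as k) (xs k)" and conv: "\<forall>i. \<forall>\<^sub>F k in sequentially. as k i = a i"
    have lim: "\<exists>x. R n (\<lambda>i. a (prod_encode (n, i))) x \<and> limitin T xs x sequentially" for n
      by (rule baire_closedD[OF cl, where as = "\<lambda>k i. as k (prod_encode (n, i))"])
        (use S S_def conv in auto)
    then obtain x where x: "limitin T xs x sequentially" by blast
    have "R n (\<lambda>i. a (prod_encode (n, i))) x" for n
      using lim[of n] limitin_Hausdorff_unique[OF _ x _ T] by auto
    then show "\<exists>x. S a x \<and> limitin T xs x sequentially" using x unfolding S_def by blast
  qed
  ultimately show ?thesis unfolding baire_image_def by blast
qed

text \<open>A code picks, for each \<open>n\<close>, a point of a countable dense set within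
  distance \<open>1 / Suc n\<close>. Convergence of codes eventually traps the points in each of
  these closed balls, so they form a Cauchy sequence and completeness supplies the limit.\<close>

lemma baire_image_closedin:
  assumes T: "completely_metrizable_space T" "second_countable T" and C: "closedin T C"
  shows "baire_image T C"
proof (cases "topspace T = {}")
  case True
  then have "C = {}" using C closedin_subset by blast
  then show ?thesis unfolding baire_image_def baire_closed_def
    by (intro exI[of _ "\<lambda>_ _. False"]) auto
next
  case False
  obtain M d where M: "Metric_space M d" "Metric_space.mcomplete M d"
    and Teq: "T = Metric_space.mtopology M d"
    using T(1) completely_metrizable_space_def by blast
  interpret Metric_space M d by (rule M)
  obtain Q where Q: "countable Q" "Q \<subseteq> M" "mtopology closure_of Q = M"
    using second_countable_imp_separable_space[OF T(2)] by (auto simp: separable_space_def Teq)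
  then have "Q \<noteq> {}" using False Teq by auto
  define q where "q = from_nat_into Q"
  have range_q: "range q = Q" unfolding q_def using \<open>Q \<noteq> {}\<close> Q(1) by (rule range_from_nat_into)
  then have qM: "q n \<in> M" for n using Q(2) by blast
  define S where "S a x \<longleftrightarrow> x \<in> C \<and> (\<forall>n. x \<in> mcball (q (a n)) (1 / Suc n))"
    for a :: "nat \<Rightarrow> nat" and x
  have CM: "C \<subseteq> M" using C closedin_subset Teq by fastforce
  have "x \<in> C \<longleftrightarrow> (\<exists>a. S a x)" for x
  proof
    assume x: "x \<in> C"
    have "\<exists>m. x \<in> mcball (q m) (1 / Suc n)" for n
    proof -
      have "x \<in> mtopology closure_of Q" using x CM Q(3) by blast
      then have "\<exists>y\<in>Q. y \<in> mcball x (1 / Suc n)"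
        unfolding metric_closure_of_alt by simp
      then show ?thesis using range_q by (metis commute in_mcball rangeE)
    qed
    then have "\<exists>a. \<forall>n. x \<in> mcball (q (a n)) (1 / Suc n)" by metis
    then show "\<exists>a. S a x" using x unfolding S_def by blast
  qed (simp add: S_def)
  moreover have "baire_closed T S"
    unfolding baire_closed_def
  proof (intro allI impI)
    fix as a xs
    assume S: "\<forall>k. S (as k) (xs k)" and conv: "\<forall>i. \<forall>\<^sub>F k in sequentially. as k i = a i"
    have xsM: "xs k \<in> M" for k using S CM unfolding S_def by blast
    have ball: "\<forall>\<^sub>F k in sequentially. xs k \<in> mcball (q (a n)) (1 / Suc n)" for n
      using conv[rule_format, of n]
    proof (rule eventually_mono)
      fix k assume "as k n = a n"
      then show "xs k \<in> mcball (q (a n)) (1 / Suc n)" using S S_def by metis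
    qed
    have "MCauchy xs"
      unfolding MCauchy_def
    proof (intro conjI allI impI)
      fix \<epsilon> :: real assume "\<epsilon> > 0"
      then obtain n where n: "1 / Suc n < \<epsilon> / 2" using nat_approx_posE[of "\<epsilon> / 2"] by auto
      obtain N where N: "\<forall>k\<ge>N. xs k \<in> mcball (q (a n)) (1 / Suc n)"
        using ball[of n] by (auto simp: eventually_sequentially)
      have "d (xs k) (xs l) < \<epsilon>" if "N \<le> k" "N \<le> l" for k l
      proof -
        have "d (q (a n)) (xs k) \<le> 1 / Suc n" "d (q (a n)) (xs l) \<le> 1 / Suc n"
          using N that by (meson in_mcball)+
        then show ?thesis
          using triangle[of "xs k" "q (a n)" "xs l"] xsM qM n commute[of "xs k" "q (a n)"] by simp
      qed
      then show "\<exists>N. \<forall>k l. N \<le> k \<longrightarrow> N \<le> l \<longrightarrow> d (xs k) (xs l) < \<epsilon>" by blast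
    qed (use xsM in auto)
    then obtain x where x: "limitin mtopology xs x sequentially" using M(2) mcomplete_def by blast
    have "x \<in> C" using limitin_closedin[OF x] C Teq S S_def by auto
    moreover have "x \<in> mcball (q (a n)) (1 / Suc n)" for n
      using limitin_closedin[OF x closedin_mcball ball] by simp
    ultimately show "\<exists>x. S a x \<and> limitin T xs x sequentially" using x unfolding Teq S_def by blast
  qed
  ultimately show ?thesis unfolding baire_image_def by blast
qed

text \<open>Carrying the complement along makes the complement step of the induction trivial; the
  complement of a union becomes an intersection. Open sets are countable unions of closed sets by
  metrizability.\<close>

lemma baire_image_borel:
  assumes T: "completely_metrizable_space T" "second_countable T"
    and B: "B \<in> sigma_sets (topspace T) {U. openin T U}"
  shows "baire_image T B \<and> baire_image T (topspace T - B)"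
  using B
proof (induction rule: sigma_sets.induct)
  case (Basic U)
  then have U: "openin T U" by simp
  have "fsigma_in T U"
    using open_imp_fsigma_in completely_metrizable_imp_metrizable_space T(1) U by blast
  then obtain C :: "nat \<Rightarrow> _" where "\<And>n. closedin T (C n)" "(\<Union>n. C n) = U"
    by (auto simp: fsigma_in_ascending)
  then have "baire_image T U" using baire_image_UN baire_image_closedin[OF T] by metis
  moreover have "baire_image T (topspace T - U)"
    by (rule baire_image_closedin[OF T]) (use U in auto)
  ultimately show ?case ..
next
  case Empty
  then show ?case using baire_image_closedin[OF T] by simp
next
  case (Compl B)
  have "topspace T - (topspace T - B) = B"
    using sigma_sets_into_sp[OF _ Compl.hyps] openin_subset by (auto simp: double_diff)
  then show ?case using Compl.IH by simp
next
  case (Union B)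
  have "Hausdorff_space T"
    by (intro metrizable_imp_Hausdorff_space completely_metrizable_imp_metrizable_space T)
  moreover have "topspace T - (\<Union>n. B n) = (\<Inter>n. topspace T - B n)" by blast
  ultimately show ?case using Union.IH baire_image_UN[of T B] baire_image_INT[of T "\<lambda>n. topspace T - B n"]
    by simp
qed

section \<open>Coding the members of an analytic family by Baire space\<close>

text \<open>A code of a point \<open>x\<close> of the Borel set serves as a code of the member with
  characteristic function \<open>f x\<close>. Convergence in the cube is coordinatewise with
  discrete factors, so membership of each vector eventually agrees with the limit.\<close>

lemma analytic_family_parametrization:
  assumes "analytic_family \<A>"
  shows "\<exists>R :: (nat \<Rightarrow> nat) \<Rightarrow> 'e set \<Rightarrow> bool. (\<forall>A. A \<in> \<A> \<longleftrightarrow> (\<exists>a. R a A)) \<and>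
    (\<forall>as a As. (\<forall>k. R (as k) (As k)) \<longrightarrow> (\<forall>i. \<forall>\<^sub>F k in sequentially. as k i = a i) \<longrightarrow>
      (\<exists>A. R a A \<and> (\<forall>v. \<forall>\<^sub>F k in sequentially. v \<in> As k \<longleftrightarrow> v \<in> A)))"
proof -
  obtain P :: "real topology" and B f where P: "completely_metrizable_space P" "second_countable P"
    and B: "B \<in> sigma_sets (topspace P) {U. openin P U}"
    and f: "continuous_map (subtopology P B) cantor_cube f"
    and img: "f ` B = (\<lambda>Y x. x \<in> Y) ` \<A>"
    using assms unfolding analytic_family_def analytic_in_def by metis
  obtain S where S: "\<And>x. x \<in> B \<longleftrightarrow> (\<exists>a. S a x)" and cl: "baire_closed P S"
    using baire_image_borel[OF P B] unfolding baire_image_def by blast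
  define R where "R a A \<longleftrightarrow> (\<exists>x. S a x \<and> A = Collect (f x))" for a A
  show ?thesis
  proof (intro exI[of _ R] conjI allI impI)
    fix A
    have "A \<in> \<A> \<longleftrightarrow> (\<lambda>v. v \<in> A) \<in> (\<lambda>Y x. x \<in> Y) ` \<A>"
      by (auto simp: fun_eq_iff image_iff set_eq_iff[symmetric])
    also have "\<dots> \<longleftrightarrow> (\<exists>x\<in>B. f x = (\<lambda>v. v \<in> A))" unfolding img[symmetric] by (metis (lifting) image_iff)
    also have "\<dots> \<longleftrightarrow> (\<exists>a. R a A)" unfolding R_def using S by (auto simp: fun_eq_iff) blast+
    finally show "A \<in> \<A> \<longleftrightarrow> (\<exists>a. R a A)" .
  next
    fix as a As
    assume R: "\<forall>k::nat. R (as k) (As k)" and conv: "\<forall>i. \<forall>\<^sub>F k in sequentially. as k i = a i"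
    obtain xs where xs: "\<And>k. S (as k) (xs k)" "\<And>k. As k = Collect (f (xs k))"
      using R unfolding R_def by metis
    obtain x where x: "S a x" "limitin P xs x sequentially"
      using baire_closedD[of P S as xs a] cl xs(1) conv by blast
    have "xs k \<in> B" "x \<in> B" for k using S xs(1) x(1) by blast+
    then have "limitin (subtopology P B) xs x sequentially"
      using x(2) by (simp add: limitin_subtopology)
    then have "limitin cantor_cube (f \<circ> xs) (f x) sequentially"
      by (rule continuous_map_limit[OF f])
    then have lim: "limitin (discrete_topology UNIV) (\<lambda>k. f (xs k) v) (f x v) sequentially" for v
      unfolding cantor_cube_def limitin_componentwise by (simp add: o_def)
    have "\<forall>\<^sub>F k in sequentially. f (xs k) v = f x v" for v
      using limitinD[OF lim[of v], of "{f x v}"] by simp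
    then show "\<exists>A. R a A \<and> (\<forall>v. \<forall>\<^sub>F k in sequentially. v \<in> As k \<longleftrightarrow> v \<in> A)"
      using x(1) xs(2) by (intro exI[of _ "Collect (f x)"]) (auto simp: R_def)
  qed
qed
section \<open>Block sequences and subspaces\<close>

context based_vector_space
begin

abbreviation coeff_at :: "nat \<Rightarrow> 'e \<Rightarrow> 'f" where
  "coeff_at n x \<equiv> representation (range e) x (e n)"

lemma coeff_at_add: "coeff_at n (x + y) = coeff_at n x + coeff_at n y"
  by (simp add: representation_add independent_basis span_basis)

lemma coeff_at_diff: "coeff_at n (x - y) = coeff_at n x - coeff_at n y"
  by (simp add: representation_diff independent_basis span_basis)

lemma coeff_at_scale: "coeff_at n (scale k x) = k * coeff_at n x"
  by (simp add: representation_scale independent_basis span_basis)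

lemma coeff_at_zero: "coeff_at n 0 = 0"
  by (simp add: representation_zero)

lemma finite_supp: "finite (supp x)"
proof -
  have "finite {b. representation (range e) x b \<noteq> 0}"
    by (rule finite_representation)
  then have "finite (e -` {b. representation (range e) x b \<noteq> 0})"
    by (rule finite_vimageI) (rule inj_basis)
  then show ?thesis by (simp add: supp_def vimage_def)
qed

lemma in_span_supp: "x \<in> span (e ` supp x)"
proof -
  have "(\<Sum>b | representation (range e) x b \<noteq> 0. scale (representation (range e) x b) b) = x"
    by (rule sum_nonzero_representation_eq) (simp_all add: independent_basis span_basis)
  moreover have "(\<Sum>b | representation (range e) x b \<noteq> 0. scale (representation (range e) x b) b)
      \<in> span (e ` supp x)"
  proof (rule span_sum)
    fix b assume "b \<in> {b. representation (range e) x b \<noteq> 0}"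
    then have b: "representation (range e) x b \<noteq> 0" by simp
    then have "b \<in> range e" by (rule representation_ne_zero)
    with b have "b \<in> e ` supp x" by (auto simp: supp_def)
    then show "scale (representation (range e) x b) b \<in> span (e ` supp x)"
      by (intro span_scale span_base)
  qed
  ultimately show ?thesis by simp
qed

lemma supp_empty_iff: "supp x = {} \<longleftrightarrow> x = 0"
proof
  assume "supp x = {}"
  with in_span_supp[of x] show "x = 0" by simp
qed (simp add: supp_def coeff_at_zero)

section \<open>Vectors supported on final and initial segments of the basis\<close>

text \<open>This is the span of the \<open>e i\<close> with \<open>i \<ge> N\<close>;
  \<open>low_space N\<close> is the complement spanned by the \<open>e i\<close> with
  \<open>i < N\<close>.\<close>

definition deep_space :: "nat \<Rightarrow> 'e set" where
  "deep_space N = {x. \<forall>i<N. coeff_at i x = 0}"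

definition low_space :: "nat \<Rightarrow> 'e set" where
  "low_space N = {x. \<forall>i\<ge>N. coeff_at i x = 0}"

lemma subspace_deep: "subspace (deep_space N)"
  by (auto simp: deep_space_def intro!: subspaceI simp: coeff_at_zero coeff_at_add coeff_at_scale)

lemma subspace_low: "subspace (low_space N)"
  by (auto simp: low_space_def intro!: subspaceI simp: coeff_at_zero coeff_at_add coeff_at_scale)

lemma in_deep_space_iff: "x \<in> deep_space N \<longleftrightarrow> (\<forall>i<N. i \<notin> supp x)"
  by (simp add: deep_space_def supp_def)

lemma in_low_space_iff: "x \<in> low_space N \<longleftrightarrow> (\<forall>i\<ge>N. i \<notin> supp x)"
  by (simp add: low_space_def supp_def)

lemma deep_space_mono: "M \<le> N \<Longrightarrow> deep_space N \<subseteq> deep_space M"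
  by (auto simp: deep_space_def)

lemma low_space_mono: "M \<le> N \<Longrightarrow> low_space M \<subseteq> low_space N"
  by (auto simp: low_space_def)

lemma deep_low_zero:
  assumes "x \<in> deep_space N" "x \<in> low_space N"
  shows "x = 0"
proof -
  have "coeff_at i x = 0" for i
    using assms by (cases "i < N") (auto simp: deep_space_def low_space_def)
  then have "supp x = {}" by (simp add: supp_def)
  then show ?thesis by (simp add: supp_empty_iff)
qed

lemma ex_low: "\<exists>N. x \<in> low_space N"
proof -
  obtain N where "\<forall>i\<in>supp x. i < N"
    using finite_supp finite_nat_set_iff_bounded by blast
  then have "x \<in> low_space N" by (auto simp: in_low_space_iff)
  then show ?thesis ..
qed

lemma finite_subset_low:
  assumes "finite S"
  shows "\<exists>N. S \<subseteq> low_space N"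
  using assms
proof (induction S rule: finite_induct)
  case (insert x S)
  then obtain N where N: "S \<subseteq> low_space N" by blast
  obtain M where "x \<in> low_space M" using ex_low by blast
  then have "insert x S \<subseteq> low_space (max M N)"
    using N low_space_mono[of M "max M N"] low_space_mono[of N "max M N"] by auto
  then show ?case ..
qed simp

lemma block_lessI:
  assumes "x \<noteq> 0" "y \<noteq> 0" "x \<in> low_space N" "y \<in> deep_space N"
  shows "block_less x y"
proof -
  have "supp x \<noteq> {}" "supp y \<noteq> {}" using assms by (simp_all add: supp_empty_iff)
  then have "Max (supp x) \<in> supp x" "Min (supp y) \<in> supp y"
    by (simp_all add: finite_supp)
  then have "Max (supp x) < N" "N \<le> Min (supp y)"
    using assms(3,4) by (meson in_deep_space_iff in_low_space_iff not_less)+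
  then show ?thesis by (simp add: block_less_def)
qed

lemma block_lessD:
  assumes "block_less x y"
  shows "x \<in> low_space (Min (supp y))" "y \<in> deep_space (Min (supp y))"
proof -
  have "i \<notin> supp x" if "Min (supp y) \<le> i" for i
    using that assms Max_ge[OF finite_supp, of i x] by (auto simp: block_less_def)
  then show "x \<in> low_space (Min (supp y))" by (simp add: in_low_space_iff)
  have "i \<notin> supp y" if "i < Min (supp y)" for i
    using that Min_le[OF finite_supp, of i y] by auto
  then show "y \<in> deep_space (Min (supp y))" by (simp add: in_deep_space_iff)
qed

text \<open>The least elements of the supports increase strictly along a block sequence; that of
  \<open>X m\<close> is a cut point and is at least \<open>m\<close>.\<close>

lemma bb_split:
  assumes "X \<in> bb"
  shows "\<exists>N\<ge>m. (\<forall>k<m. X k \<in> low_space N) \<and> (\<forall>k\<ge>m. X k \<in> deep_space N)"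
proof -
  define f where "f k = Min (supp (X k))" for k
  have step: "f k < f (Suc k)" "X k \<in> low_space (f (Suc k))" for k
  proof -
    have b: "block_less (X k) (X (Suc k))" and nz: "X k \<noteq> 0" "X (Suc k) \<noteq> 0"
      using assms by (auto simp: bb_def)
    show "X k \<in> low_space (f (Suc k))" using block_lessD(1)[OF b] by (simp add: f_def)
    have "supp (X k) \<noteq> {}" using nz by (simp add: supp_empty_iff)
    then have "f k \<le> Max (supp (X k))" by (simp add: f_def finite_supp)
    then show "f k < f (Suc k)" using b by (simp add: block_less_def f_def)
  qed
  have mono: "strict_mono f" using step(1) by (simp add: strict_mono_Suc_iff)
  have deep: "X k \<in> deep_space (f k)" for k
  proof -
    have "i \<notin> supp (X k)" if "i < f k" for i
      using that Min_le[OF finite_supp, of i "X k"] by (auto simp: f_def)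
    then show ?thesis by (simp add: in_deep_space_iff)
  qed
  have "\<forall>k<m. X k \<in> low_space (f m)"
    using step(2) low_space_mono strict_mono_leD[OF mono] by (meson Suc_leI subsetD)
  moreover have "\<forall>k\<ge>m. X k \<in> deep_space (f m)"
    using deep deep_space_mono strict_mono_leD[OF mono] by (meson subsetD)
  moreover have "m \<le> f m" using mono by (rule strict_mono_imp_increasing)
  ultimately show ?thesis by blast
qed

lemma bb_deep: "X \<in> bb \<Longrightarrow> X n \<in> deep_space n"
  using bb_split[of X n] deep_space_mono by blast

lemma bb_shift: "X \<in> bb \<Longrightarrow> (\<lambda>n. X (n + N)) \<in> bb"
  by (simp add: bb_def)

text \<open>Split \<open>v\<close> into a part \<open>u\<close> from the first \<open>m\<close>
  terms and a part \<open>w\<close> from the rest. With a cut point \<open>N\<close> between them,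
  \<open>u = v - w\<close> is both low and deep, hence zero.\<close>

lemma seq_span_tail:
  assumes X: "X \<in> bb"
  shows "\<exists>N. \<forall>v \<in> seq_span X \<inter> deep_space N. v \<in> span (X ` {m..})"
proof -
  obtain N where low: "\<forall>k<m. X k \<in> low_space N" and deep: "\<forall>k\<ge>m. X k \<in> deep_space N"
    using bb_split[OF X] by blast
  have "v \<in> span (X ` {m..})" if v: "v \<in> seq_span X" "v \<in> deep_space N" for v
  proof -
    have "range X = X ` {..<m} \<union> X ` {m..}" 
      unfolding image_Un[symmetric] by (rule arg_cong[of _ _ "image X"]) auto
    then obtain u w where uw: "v = u + w" "u \<in> span (X ` {..<m})" "w \<in> span (X ` {m..})"
      using v(1) unfolding seq_span_def by (simp add: span_Un) blast
    have "u \<in> low_space N"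
      using uw(2) low span_minimal[OF _ subspace_low, of "X ` {..<m}" N] by auto
    have "w \<in> deep_space N"
      using uw(3) deep span_minimal[OF _ subspace_deep, of "X ` {m..}" N] by auto
    then have "u \<in> deep_space N"
      using v(2) uw(1) subspace_diff[OF subspace_deep, of v N w] by simp
    then have "u = 0" using \<open>u \<in> low_space N\<close> by (rule deep_low_zero)
    then show ?thesis using uw by simp
  qed
  then show ?thesis by blast
qed

section \<open>Finite dimension tested by deep vectors\<close>

lemma finite_dimI:
  assumes "subspace S" "S \<subseteq> span B" "finite B"
  shows "finite_dim S"
proof -
  obtain C where C: "C \<subseteq> S" "independent C" "S \<subseteq> span C"
    using maximal_independent_subset by blast
  have "finite C" using independent_span_bound[OF assms(3) C(2)] C(1) assms(2) by blast
  moreover have "span C = S" using C assms(1) by (simp add: span_subspace)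
  ultimately show ?thesis using C(2) finite_dim_def by blast
qed

lemma finite_dim_subset:
  assumes "finite_dim T" "S \<subseteq> T" "subspace S"
  shows "finite_dim S"
  using assms finite_dimI by (auto simp: finite_dim_def)

lemma finite_dim_low:
  assumes "finite_dim S"
  shows "\<exists>N. S \<subseteq> low_space N"
proof -
  obtain B where "finite B" "span B = S" using assms finite_dim_def by blast
  then show ?thesis using finite_subset_low[of B] span_minimal[OF _ subspace_low] by blast
qed

lemma finite_dim_codim_one:
  assumes S: "subspace S" and T: "finite_dim T" and "\<forall>x\<in>S. \<exists>k. x - scale k w \<in> T"
  shows "finite_dim S"
proof -
  obtain B where "finite B" "span B = T" using T finite_dim_def by blast
  then show ?thesis using assms by (intro finite_dimI[of S "insert w B"]) (auto simp: span_insert)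
qed

text \<open>Each further coordinate forced to vanish lowers the dimension by at most one: multiples
  of a single \<open>w\<close> with nonzero coordinate \<open>N\<close> cancel that coordinate in
  all other vectors.\<close>

lemma infinite_dim_Int_deep:
  assumes S: "subspace S" "\<not> finite_dim S"
  shows "\<not> finite_dim (S \<inter> deep_space N)"
proof (induction N)
  case 0
  then show ?case using S by (simp add: deep_space_def)
next
  case (Suc N)
  show ?case
  proof
    assume fin: "finite_dim (S \<inter> deep_space (Suc N))"
    have sub: "subspace (S \<inter> deep_space N)" by (intro subspace_inter S subspace_deep)
    have eq: "x \<in> deep_space (Suc N) \<longleftrightarrow> x \<in> deep_space N \<and> coeff_at N x = 0" for x
      by (auto simp: deep_space_def less_Suc_eq)
    show False
    proof (cases "\<exists>w \<in> S \<inter> deep_space N. coeff_at N w \<noteq> 0")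
      case True
      then obtain w where w: "w \<in> S \<inter> deep_space N" "coeff_at N w \<noteq> 0" by blast
      have "\<exists>k. x - scale k w \<in> S \<inter> deep_space (Suc N)" if "x \<in> S \<inter> deep_space N" for x
      proof
        let ?k = "coeff_at N x / coeff_at N w"
        have "x - scale ?k w \<in> S \<inter> deep_space N"
          using that w sub by (intro subspace_diff subspace_scale)
        moreover have "coeff_at N (x - scale ?k w) = 0"
          using w(2) by (simp add: coeff_at_diff coeff_at_scale)
        ultimately show "x - scale ?k w \<in> S \<inter> deep_space (Suc N)" by (simp add: eq)
      qed
      then have "finite_dim (S \<inter> deep_space N)" using finite_dim_codim_one[OF sub fin] by blast
      then show False using Suc.IH by blast
    next
      case False
      then have "S \<inter> deep_space N = S \<inter> deep_space (Suc N)" using eq by blast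
      then show False using fin Suc.IH by simp
    qed
  qed
qed

text \<open>A finite-dimensional space lies in some \<open>low_space N\<close>, and cutting down to
  \<open>deep_space N\<close> cannot destroy infinite dimension. Infinite dimension thus means
  having nonzero vectors beyond every \<open>N\<close>.\<close>

lemma finite_dim_iff:
  assumes "subspace S"
  shows "finite_dim S \<longleftrightarrow> (\<exists>N. S \<inter> deep_space N \<subseteq> {0})"
proof
  assume "finite_dim S"
  then obtain N where "S \<subseteq> low_space N" using finite_dim_low by blast
  then have "S \<inter> deep_space N \<subseteq> {0}" using deep_low_zero by blast
  then show "\<exists>N. S \<inter> deep_space N \<subseteq> {0}" ..
next
  assume "\<exists>N. S \<inter> deep_space N \<subseteq> {0}"
  then obtain N where "S \<inter> deep_space N \<subseteq> span {}" by auto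
  then have "finite_dim (S \<inter> deep_space N)"
    by (rule finite_dimI[rotated]) (simp_all add: subspace_inter assms subspace_deep)
  then show "finite_dim S" using infinite_dim_Int_deep[OF assms] by blast
qed

lemma finite_dim_span_Int:
  assumes "subspace G" "subspace Y" "finite_dim (G \<inter> Y)" "finite h"
  shows "finite_dim (span (G \<union> h) \<inter> Y)"
  using assms(4)
proof (induction h rule: finite_induct)
  case empty
  then show ?case using assms by (simp add: span_eq_iff[THEN iffD2])
next
  case (insert a h)
  let ?T = "span (G \<union> h)"
  have sub: "subspace (span (G \<union> insert a h) \<inter> Y)" by (intro subspace_inter subspace_span assms)
  have mem: "x \<in> span (G \<union> insert a h) \<longleftrightarrow> (\<exists>k. x - scale k a \<in> ?T)" for x
    by (simp add: span_insert)
  show ?case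
  proof (cases "span (G \<union> insert a h) \<inter> Y \<subseteq> ?T")
    case True
    then show ?thesis by (intro finite_dim_subset[OF insert.IH _ sub]) blast
  next
    case False
    \<comment> \<open>\<open>w\<close> is an element of \<open>Y\<close> that really involves the
      new vector \<open>a\<close>; subtracting the multiple \<open>j / k\<close> of it removes the
      \<open>a\<close>-component of any other element without leaving \<open>Y\<close>.\<close>
    then obtain w k where w: "w \<in> Y" "w \<notin> ?T" "w - scale k a \<in> ?T" using mem by blast
    have "k \<noteq> 0" using w by auto
    have "\<exists>l. x - scale l w \<in> ?T \<inter> Y" if x: "x \<in> span (G \<union> insert a h) \<inter> Y" for x
    proof -
      obtain j where j: "x - scale j a \<in> ?T" using x mem by blast
      have "x - scale (j / k) w = (x - scale j a) - scale (j / k) (w - scale k a)"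
        using \<open>k \<noteq> 0\<close> by (simp add: scale_right_diff_distrib)
      then have "x - scale (j / k) w \<in> ?T" using j w(3) by (metis span_diff span_scale)
      moreover have "x - scale (j / k) w \<in> Y"
        using x w(1) assms(2) by (intro subspace_diff subspace_scale) auto
      ultimately show ?thesis by blast
    qed
    then show ?thesis using finite_dim_codim_one[OF sub insert.IH] by blast
  qed
qed

text \<open>This is the recursion for the diagonal constructions below. \<open>P\<close> may refer
  to the finite set \<open>h\<close> of earlier vectors, and the freedom in \<open>N\<close> keeps
  consecutive supports in order.\<close>

lemma ex_block_sequence:
  assumes "\<And>n h N. finite h \<Longrightarrow> \<exists>x. x \<noteq> 0 \<and> x \<in> deep_space N \<and> P n h x"
  shows "\<exists>X\<in>bb. \<forall>n. P n (X ` {..<n}) (X n)"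
proof -
  \<comment> \<open>A state \<open>(h, x)\<close> holds the current vector \<open>x\<close> and the
    set \<open>h\<close> of vectors before it; \<open>x\<close> enters the history only at the next
    step.\<close>
  define inv where "inv n s \<longleftrightarrow> (case s of (h, x) \<Rightarrow> finite h \<and> x \<noteq> 0 \<and> P n h x)"
    for n and s :: "'e set \<times> 'e"
  define step where "step s t \<longleftrightarrow> (case s of (h, x) \<Rightarrow> case t of (h', y) \<Rightarrow>
      h' = insert x h \<and> (\<exists>N. x \<in> low_space N \<and> y \<in> deep_space N))"
    for s t :: "'e set \<times> 'e"
  obtain x0 where x0: "x0 \<noteq> 0" "P 0 {} x0" using assms[of "{}" 0 0] by auto
  have "\<exists>f. \<forall>n. (inv n (f n) \<and> (n = 0 \<longrightarrow> fst (f n) = {})) \<and> step (f n) (f (Suc n))"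
  proof (rule dependent_nat_choice)
    show "\<exists>s. inv 0 s \<and> (0 = (0::nat) \<longrightarrow> fst s = {})"
      using x0 by (intro exI[of _ "({}, x0)"]) (simp add: inv_def)
  next
    fix s n assume s: "inv n s \<and> (n = 0 \<longrightarrow> fst s = {})"
    obtain h x where hx: "s = (h, x)" by fastforce
    obtain N where N: "x \<in> low_space N" using ex_low by blast
    have "finite (insert x h)" using s hx by (simp add: inv_def)
    then obtain y where "y \<noteq> 0" "y \<in> deep_space N" "P (Suc n) (insert x h) y"
      using assms by blast
    then show "\<exists>t. (inv (Suc n) t \<and> (Suc n = 0 \<longrightarrow> fst t = {})) \<and> step s t"
      using s hx N by (intro exI[of _ "(insert x h, y)"]) (auto simp: inv_def step_def)
  qed
  then obtain f where f: "\<And>n. inv n (f n)" "fst (f 0) = {}" "\<And>n. step (f n) (f (Suc n))"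
    by blast
  define X where "X n = snd (f n)" for n
  have hist: "fst (f n) = X ` {..<n}" for n
  proof (induction n)
    case (Suc n)
    have "fst (f (Suc n)) = insert (X n) (fst (f n))"
      using f(3)[of n] by (auto simp: step_def X_def split: prod.splits)
    then show ?case using Suc by (simp add: lessThan_Suc)
  qed (simp add: f(2))
  have "X n \<noteq> 0" "P n (X ` {..<n}) (X n)" for n
    using f(1)[of n] hist[of n] by (auto simp: inv_def X_def split: prod.splits)
  moreover have "block_less (X n) (X (Suc n))" for n
  proof -
    have "\<exists>N. X n \<in> low_space N \<and> X (Suc n) \<in> deep_space N"
      using f(3)[of n] by (auto simp: step_def X_def split: prod.splits)
    then show ?thesis using calculation(1) block_lessI by blast
  qed
  ultimately show ?thesis by (auto simp: bb_def)
qed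

section \<open>The coideal of a mad family\<close>


text \<open>Every vector lies in the span of finitely many basis vectors, which is countable over a
  countable field. This is what makes the cells countable in number.\<close>

lemma countable_vectors: "countable (UNIV :: 'e set)"
proof -
  have fin: "countable (span S)" if "finite S" for S
    using that
  proof (induction S rule: finite_induct)
    case (insert a S)
    have "span (insert a S) \<subseteq> (\<lambda>(k, y). y + scale k a) ` (UNIV \<times> span S)"
    proof
      fix x assume "x \<in> span (insert a S)"
      then obtain k where "x - scale k a \<in> span S" by (auto simp: span_insert)
      then show "x \<in> (\<lambda>(k, y). y + scale k a) ` (UNIV \<times> span S)"
        by (intro image_eqI[of _ _ "(k, x - scale k a)"]) auto
    qed
    then show ?case
      by (rule countable_subset) (intro countable_image countable_SIGMA countable_field insert.IH)
  qed simp
  have "UNIV = (\<Union>F\<in>Collect finite. span (e ` F))"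
    using in_span_supp finite_supp by blast
  also have "countable \<dots>"
    by (intro countable_UN countable_Collect_finite fin) auto
  finally show ?thesis .
qed

lemma subspace_seq_span: "subspace (seq_span X)"
  by (simp add: seq_span_def)

lemma in_seq_span: "X n \<in> seq_span X"
  by (simp add: seq_span_def span_base)

lemma seq_span_minimal: "(\<And>n. X n \<in> S) \<Longrightarrow> subspace S \<Longrightarrow> seq_span X \<subseteq> S"
  unfolding seq_span_def by (rule span_minimal) auto

lemma bb_nonzero: "X \<in> bb \<Longrightarrow> X n \<noteq> 0"
  by (simp add: bb_def)

lemma infinite_dimI:
  assumes "subspace S" "\<And>N. \<exists>x. x \<noteq> 0 \<and> x \<in> deep_space N \<and> x \<in> S"
  shows "\<not> finite_dim S"
  using assms by (auto simp: finite_dim_iff)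

lemma infinite_dimD:
  assumes "\<not> finite_dim S" "subspace S"
  shows "\<exists>x. x \<noteq> 0 \<and> x \<in> deep_space N \<and> x \<in> S"
  using assms by (auto simp: finite_dim_iff)

section \<open>Almost inclusion and diagonal sequences\<close>

text \<open>Inclusion of spans up to finite codimension. This is what a diagonal sequence achieves,
  since its terms lie in the \<open>j\<close>-th span only from index \<open>j\<close> on.\<close>

definition almost_below :: "(nat \<Rightarrow> 'e) \<Rightarrow> (nat \<Rightarrow> 'e) \<Rightarrow> bool" where
  "almost_below Y X \<longleftrightarrow> (\<exists>N. seq_span Y \<inter> deep_space N \<subseteq> seq_span X)"

lemma almost_below_refl: "almost_below X X"
  by (auto simp: almost_below_def)

lemma preceq_almost_below: "Y \<preceq> X \<Longrightarrow> almost_below Y X"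
  by (auto simp: almost_below_def preceq_def)

lemma almost_below_trans:
  assumes "almost_below Z Y" "almost_below Y X"
  shows "almost_below Z X"
proof -
  obtain M N where "seq_span Z \<inter> deep_space M \<subseteq> seq_span Y" "seq_span Y \<inter> deep_space N \<subseteq> seq_span X"
    using assms almost_below_def by blast
  then have "seq_span Z \<inter> deep_space (max M N) \<subseteq> seq_span X"
    using deep_space_mono[of M "max M N"] deep_space_mono[of N "max M N"] by auto
  then show ?thesis using almost_below_def by blast
qed

lemma infinite_dim_almost_below:
  assumes "almost_below Y X" "subspace A" "\<not> finite_dim (seq_span Y \<inter> A)"
  shows "\<not> finite_dim (seq_span X \<inter> A)"
proof -
  obtain M where M: "seq_span Y \<inter> deep_space M \<subseteq> seq_span X"
    using assms(1) almost_below_def by blast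
  show ?thesis
  proof (rule infinite_dimI)
    fix N
    obtain x where "x \<noteq> 0" "x \<in> deep_space (max M N)" "x \<in> seq_span Y \<inter> A"
      using infinite_dimD[OF assms(3)] subspace_inter[OF subspace_seq_span assms(2)] by blast
    then show "\<exists>x. x \<noteq> 0 \<and> x \<in> deep_space N \<and> x \<in> seq_span X \<inter> A"
      using M deep_space_mono[of M "max M N"] deep_space_mono[of N "max M N"] by auto
  qed (intro subspace_inter subspace_seq_span assms(2))
qed

lemma seq_span_infinite_dim:
  assumes "Z \<in> bb"
  shows "\<not> finite_dim (seq_span Z)"
  using infinite_dimI[OF subspace_seq_span] bb_deep[OF assms] bb_nonzero[OF assms] in_seq_span
  by blast

text \<open>By \<open>seq_span_tail\<close>, deep enough vectors of the span use only terms with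
  index at least \<open>j\<close>.\<close>

lemma almost_below_diagonal:
  assumes "X \<in> bb" "\<And>n j. j \<le> n \<Longrightarrow> X n \<in> seq_span (Xs j)"
  shows "almost_below X (Xs j)"
proof -
  obtain N where "\<forall>v \<in> seq_span X \<inter> deep_space N. v \<in> span (X ` {j..})"
    using seq_span_tail[OF assms(1)] by blast
  moreover have "span (X ` {j..}) \<subseteq> seq_span (Xs j)"
    using assms(2) by (intro span_minimal subspace_seq_span) auto
  ultimately show ?thesis unfolding almost_below_def by blast
qed

lemma almost_below_chain:
  assumes "\<And>n. almost_below (Xs (Suc n)) (Xs n)"
  shows "\<exists>N. \<forall>j\<le>n. seq_span (Xs n) \<inter> deep_space N \<subseteq> seq_span (Xs j)"
proof (induction n)
  case (Suc n)
  obtain M where M: "seq_span (Xs (Suc n)) \<inter> deep_space M \<subseteq> seq_span (Xs n)"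
    using assms almost_below_def by blast
  obtain N where N: "\<forall>j\<le>n. seq_span (Xs n) \<inter> deep_space N \<subseteq> seq_span (Xs j)"
    using Suc by blast
  have "\<forall>j\<le>Suc n. seq_span (Xs (Suc n)) \<inter> deep_space (max M N) \<subseteq> seq_span (Xs j)"
    using M N deep_space_mono[of M "max M N"] deep_space_mono[of N "max M N"]
    by (auto simp: le_Suc_eq) blast
  then show ?case ..
qed auto

text \<open>Beyond a suitable depth the span of \<open>Xs n\<close> lies in all earlier spans, so
  one deep vector serves all \<open>j \<le> n\<close> at once.\<close>

lemma chain_deep_vector:
  assumes "\<And>n. almost_below (Xs (Suc n)) (Xs n)"
    and "subspace Y" "\<not> finite_dim (seq_span (Xs n) \<inter> Y)"
  shows "\<exists>x. x \<noteq> 0 \<and> x \<in> deep_space N \<and> x \<in> Y \<and> (\<forall>j\<le>n. x \<in> seq_span (Xs j))"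
proof -
  obtain M where M: "\<forall>j\<le>n. seq_span (Xs n) \<inter> deep_space M \<subseteq> seq_span (Xs j)"
    using almost_below_chain[where Xs = Xs, OF assms(1)] by blast
  obtain x where "x \<noteq> 0" "x \<in> deep_space (max M N)" "x \<in> seq_span (Xs n) \<inter> Y"
    using infinite_dimD[OF assms(3)] subspace_inter[OF subspace_seq_span assms(2)] by blast
  then show ?thesis
    using M deep_space_mono[of M "max M N"] deep_space_mono[of N "max M N"]
    by (intro exI[of _ x]) auto
qed

text \<open>Infinitely many members of \<open>\<B>\<close> are listed so that each recurs infinitely
  often, and the \<open>n\<close>-th term of a diagonal sequence is taken from the
  \<open>n\<close>-th listed member.\<close>

lemma pseudo_intersection:
  assumes chain: "\<And>n. almost_below (Xs (Suc n)) (Xs n)"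
    and "infinite \<B>" and sub: "\<And>Y. Y \<in> \<B> \<Longrightarrow> subspace Y"
    and meets: "\<And>Y n. Y \<in> \<B> \<Longrightarrow> \<not> finite_dim (seq_span (Xs n) \<inter> Y)"
  shows "\<exists>X\<in>bb. (\<forall>n. almost_below X (Xs n)) \<and>
    infinite {Y \<in> \<B>. \<not> finite_dim (seq_span X \<inter> Y)}"
proof -
  obtain f :: "nat \<Rightarrow> 'e set" where f: "inj f" "range f \<subseteq> \<B>"
    using infinite_countable_subset[OF \<open>infinite \<B>\<close>] by blast
  define g where "g n = f (fst (prod_decode n))" for n
  have g: "g n \<in> \<B>" for n using f(2) by (auto simp: g_def)
  have "\<exists>X\<in>bb. \<forall>n. X n \<in> g n \<and> (\<forall>j\<le>n. X n \<in> seq_span (Xs j))"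
    by (rule ex_block_sequence) (use chain_deep_vector[where Xs = Xs, OF chain sub[OF g] meets[OF g]] in blast)
  then obtain X where X: "X \<in> bb" "\<And>n. X n \<in> g n" "\<And>n j. j \<le> n \<Longrightarrow> X n \<in> seq_span (Xs j)"
    by blast
  have "\<not> finite_dim (seq_span X \<inter> f k)" for k
  proof (rule infinite_dimI)
    show "subspace (seq_span X \<inter> f k)"
      using f(2) sub by (intro subspace_inter subspace_seq_span) blast
    fix N
    \<comment> \<open>At this index the listed member is \<open>f k\<close>, and the index is at
      least \<open>N\<close>, so the term there lies in \<open>deep_space N\<close>.\<close>
    let ?n = "prod_encode (k, N)"
    have "X ?n \<in> f k" using X(2)[of ?n] by (simp add: g_def)
    moreover have "X ?n \<in> deep_space N"
      using bb_deep[OF X(1), of ?n] deep_space_mono[OF le_prod_encode_2] by blast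
    ultimately show "\<exists>x. x \<noteq> 0 \<and> x \<in> deep_space N \<and> x \<in> seq_span X \<inter> f k"
      using bb_nonzero[OF X(1)] in_seq_span by blast
  qed
  then have "range f \<subseteq> {Y \<in> \<B>. \<not> finite_dim (seq_span X \<inter> Y)}" using f(2) by blast
  then have "infinite {Y \<in> \<B>. \<not> finite_dim (seq_span X \<inter> Y)}"
    using range_inj_infinite[OF f(1)] infinite_super by blast
  then show ?thesis using X(1) almost_below_diagonal[where Xs = Xs, OF X(1) X(3)] by blast
qed

section \<open>Maximality and lower bounds of decreasing sequences\<close>

lemma mad_family_subspace: "mad_family \<A> \<Longrightarrow> Y \<in> \<A> \<Longrightarrow> subspace Y"
  by (auto simp: mad_family_def ad_family_def infinite_dim_subspace_def)

lemma mad_family_infinite_dim: "mad_family \<A> \<Longrightarrow> Y \<in> \<A> \<Longrightarrow> \<not> finite_dim Y"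
  by (auto simp: mad_family_def ad_family_def infinite_dim_subspace_def)

lemma mad_family_eqI:
  assumes "mad_family \<A>" "Y \<in> \<A>" "Z \<in> \<A>" "\<not> finite_dim (Y \<inter> Z)"
  shows "Y = Z"
  using assms by (auto simp: mad_family_def ad_family_def pairwise_def almost_disjoint_def)

text \<open>Otherwise the span of \<open>Z\<close> could be added to the family; it is not yet a
  member, since its intersection with itself is infinite-dimensional.\<close>

lemma mad_family_meets:
  assumes mad: "mad_family \<A>" and Z: "Z \<in> bb"
  shows "\<exists>Y\<in>\<A>. \<not> finite_dim (seq_span Z \<inter> Y)"
proof (rule ccontr)
  assume "\<not> ?thesis"
  then have fin: "finite_dim (seq_span Z \<inter> Y)" if "Y \<in> \<A>" for Y using that by blast
  then have "seq_span Z \<notin> \<A>" using seq_span_infinite_dim[OF Z] by force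
  moreover have "ad_family (insert (seq_span Z) \<A>)"
    using mad fin seq_span_infinite_dim[OF Z] subspace_seq_span
    by (auto simp: mad_family_def ad_family_def infinite_dim_subspace_def pairwise_insert
        almost_disjoint_def Int_commute)
  ultimately show False using mad unfolding mad_family_def by blast
qed

text \<open>A diagonal block sequence \<open>Z\<close> is built so that its span meets no member of \<open>F\<close>;
  the member that meets \<open>Z\<close> by maximality is then new.\<close>

lemma mad_family_meets_chain:
  assumes mad: "mad_family \<A>"
    and chain: "\<And>n. almost_below (Xs (Suc n)) (Xs n)" and H: "\<And>n. Xs n \<in> H_of \<A>"
    and F: "finite F" "F \<subseteq> \<A>"
  shows "\<exists>Y\<in>\<A> - F. \<forall>n. \<not> finite_dim (seq_span (Xs n) \<inter> Y)"
proof -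
  have "\<exists>Z\<in>bb. \<forall>n. (\<forall>j\<le>n. Z n \<in> seq_span (Xs j)) \<and> (\<forall>G\<in>F. Z n \<notin> span (G \<union> Z ` {..<n}))"
  proof (rule ex_block_sequence)
    fix n N and h :: "'e set" assume h: "finite h"
    \<comment> \<open>Some member \<open>Y\<close> outside \<open>F\<close> meets the span of
      \<open>Xs n\<close>. The next term is taken in \<open>Y\<close>, which meets each span of
      \<open>G \<union> h\<close> in finite dimension, so depth alone keeps the term out of these
      spans.\<close>
    have "infinite ({Y \<in> \<A>. \<not> finite_dim (seq_span (Xs n) \<inter> Y)} - F)"
      using H[of n] F(1) by (auto simp: H_of_def)
    then have "{Y \<in> \<A>. \<not> finite_dim (seq_span (Xs n) \<inter> Y)} - F \<noteq> {}"
      by (rule infinite_imp_nonempty)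
    then obtain Y where Y: "Y \<in> \<A>" "Y \<notin> F" "\<not> finite_dim (seq_span (Xs n) \<inter> Y)"
      by blast
    have "\<exists>M. span (G \<union> h) \<inter> Y \<inter> deep_space M \<subseteq> {0}" if "G \<in> F" for G
    proof -
      have sub: "subspace G" "subspace Y" using mad_family_subspace[OF mad] F(2) that Y(1) by blast+
      have "finite_dim (G \<inter> Y)" using mad_family_eqI[OF mad] Y that F(2) by blast
      then have "finite_dim (span (G \<union> h) \<inter> Y)" using finite_dim_span_Int sub h by blast
      then show ?thesis using sub by (simp add: finite_dim_iff subspace_inter)
    qed
    then obtain M where M: "\<And>G. G \<in> F \<Longrightarrow> span (G \<union> h) \<inter> Y \<inter> deep_space (M G) \<subseteq> {0}"
      by metis
    let ?K = "Max (insert N (M ` F))"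
    have K: "N \<le> ?K" "\<And>G. G \<in> F \<Longrightarrow> M G \<le> ?K" using F(1) by auto
    obtain x where x: "x \<noteq> 0" "x \<in> deep_space ?K" "x \<in> Y" "\<forall>j\<le>n. x \<in> seq_span (Xs j)"
      using chain_deep_vector[where Xs = Xs, OF chain mad_family_subspace[OF mad Y(1)] Y(3)] by blast
    have "x \<in> deep_space N" using x(2) deep_space_mono[OF K(1)] by blast
    moreover have "x \<notin> span (G \<union> h)" if "G \<in> F" for G
      using M[OF that] x(1,2,3) deep_space_mono[OF K(2)[OF that]] by blast
    ultimately show "\<exists>x. x \<noteq> 0 \<and> x \<in> deep_space N \<and>
        (\<forall>j\<le>n. x \<in> seq_span (Xs j)) \<and> (\<forall>G\<in>F. x \<notin> span (G \<union> h))"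
      using x by blast
  qed
  then obtain Z where Z: "Z \<in> bb" "\<And>n j. j \<le> n \<Longrightarrow> Z n \<in> seq_span (Xs j)"
    "\<And>n G. G \<in> F \<Longrightarrow> Z n \<notin> span (G \<union> Z ` {..<n})" by blast
  \<comment> \<open>If the last term had a nonzero coefficient \<open>k\<close>, it would lie in the
    span of \<open>G\<close> and the earlier terms; so the terms can be removed one by one.\<close>
  have disj: "v = 0" if G: "G \<in> F" and v: "v \<in> G" "v \<in> span (Z ` {..<n})" for G v n
    using v
  proof (induction n arbitrary: v)
    case (Suc n)
    obtain k where k: "v - scale k (Z n) \<in> span (Z ` {..<n})"
      using Suc.prems(2) by (auto simp: lessThan_Suc span_insert)
    have "k = 0"
    proof (rule ccontr)
      assume "k \<noteq> 0"
      have "v \<in> span (G \<union> Z ` {..<n})" using Suc.prems(1) by (simp add: span_base)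
      moreover have "v - scale k (Z n) \<in> span (G \<union> Z ` {..<n})"
        using k span_mono[of "Z ` {..<n}" "G \<union> Z ` {..<n}"] by blast
      ultimately have "v - (v - scale k (Z n)) \<in> span (G \<union> Z ` {..<n})" by (rule span_diff)
      then have "scale k (Z n) \<in> span (G \<union> Z ` {..<n})" by simp
      then have "scale (inverse k) (scale k (Z n)) \<in> span (G \<union> Z ` {..<n})" by (rule span_scale)
      then show False using Z(3)[OF G] \<open>k \<noteq> 0\<close> by simp
    qed
    then show ?case using Suc.IH Suc.prems(1) k by simp
  qed simp
  obtain Y where Y: "Y \<in> \<A>" "\<not> finite_dim (seq_span Z \<inter> Y)"
    using mad_family_meets[OF mad Z(1)] by blast
  have "Y \<notin> F"
  proof
    assume "Y \<in> F"
    obtain v where v: "v \<noteq> 0" "v \<in> seq_span Z" "v \<in> Y"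
      using infinite_dimD[OF Y(2)] subspace_inter[OF subspace_seq_span mad_family_subspace[OF mad Y(1)]]
      by blast
    have "\<exists>n. v \<in> span (Z ` {..<n})"
      using v(2) unfolding seq_span_def
    proof (induction rule: span_induct_alt)
      case base
      show ?case by (simp add: span_zero)
    next
      case (step c x y)
      then obtain m n where x: "x = Z m" and y: "y \<in> span (Z ` {..<n})" by blast
      let ?k = "max (Suc m) n"
      have "x \<in> span (Z ` {..<?k})" unfolding x by (intro span_base) auto
      moreover have "y \<in> span (Z ` {..<?k})"
        using y span_mono[of "Z ` {..<n}" "Z ` {..<?k}"] by (auto simp: image_mono)
      ultimately show ?case by (blast intro: span_add span_scale)
    qed
    then show False using disj \<open>Y \<in> F\<close> v by blast
  qed
  moreover have "\<not> finite_dim (seq_span (Xs n) \<inter> Y)" for n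
    using infinite_dim_almost_below almost_below_diagonal[where Xs = Xs, OF Z(1,2)] mad_family_subspace[OF mad] Y
    by blast
  ultimately show ?thesis using Y(1) by blast
qed

text \<open>If only finitely many members met every span of the chain,
  \<open>mad_family_meets_chain\<close> with these as \<open>F\<close> would produce another. Hence
  infinitely many do, and \<open>pseudo_intersection\<close> applies to them.\<close>

lemma H_of_sigma_closed:
  assumes mad: "mad_family \<A>"
    and chain: "\<And>n. almost_below (Xs (Suc n)) (Xs n)" and H: "\<And>n. Xs n \<in> H_of \<A>"
  shows "\<exists>X\<in>H_of \<A>. \<forall>n. almost_below X (Xs n)"
proof -
  let ?B = "{Y \<in> \<A>. \<forall>n. \<not> finite_dim (seq_span (Xs n) \<inter> Y)}"
  have inf: "infinite ?B"
  proof
    assume "finite ?B"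
    then show False using mad_family_meets_chain[where Xs = Xs, OF mad chain H, of ?B] by blast
  qed
  obtain X where X: "X \<in> bb" "\<forall>n. almost_below X (Xs n)"
      "infinite {Y \<in> ?B. \<not> finite_dim (seq_span X \<inter> Y)}"
    using pseudo_intersection[where Xs = Xs, OF chain inf] mad_family_subspace[OF mad] by blast
  have "{Y \<in> ?B. \<not> finite_dim (seq_span X \<inter> Y)} \<subseteq> {Y \<in> \<A>. \<not> finite_dim (seq_span X \<inter> Y)}"
    by blast
  then have "X \<in> H_of \<A>" using X(1,3) infinite_super unfolding H_of_def by blast
  then show ?thesis using X(2) by blast
qed

text \<open>The constant chain at \<open>e\<close> spans everything, so every member meets it in
  infinite dimension and \<open>pseudo_intersection\<close> applies.\<close>

lemma H_of_nonempty:
  assumes mad: "mad_family \<A>" and "infinite \<A>"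
  shows "\<exists>X. X \<in> H_of \<A>"
proof -
  have "seq_span e = UNIV" by (simp add: seq_span_def span_basis)
  then show ?thesis
    using pseudo_intersection[of "\<lambda>_. e" \<A>] assms(2) almost_below_refl mad_family_subspace[OF mad]
      mad_family_infinite_dim[OF mad]
    unfolding H_of_def by auto
qed

text \<open>The requirements are met one at a time along a decreasing sequence; being inherited
  along \<open>almost_below\<close>, they all hold at a lower bound of it.\<close>

lemma H_of_fusion:
  fixes P :: "'i \<Rightarrow> (nat \<Rightarrow> 'e) \<Rightarrow> bool"
  assumes mad: "mad_family \<A>" and X0: "X0 \<in> H_of \<A>" and count: "countable (UNIV :: 'i set)"
    and dense: "\<And>i Y. Y \<in> H_of \<A> \<Longrightarrow> almost_below Y X0 \<Longrightarrow>
      \<exists>Y'\<in>H_of \<A>. almost_below Y' Y \<and> P i Y'"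
    and mono: "\<And>i Y Y'. P i Y \<Longrightarrow> almost_below Y' Y \<Longrightarrow> P i Y'"
  shows "\<exists>X\<in>H_of \<A>. almost_below X X0 \<and> (\<forall>i. P i X)"
proof -
  obtain enum :: "nat \<Rightarrow> 'i" where enum: "range enum = UNIV"
    using range_from_nat_into[OF _ count] by blast
  have "\<exists>Xs. \<forall>n. (Xs n \<in> H_of \<A> \<and> almost_below (Xs n) X0) \<and>
      (almost_below (Xs (Suc n)) (Xs n) \<and> P (enum n) (Xs (Suc n)))"
  proof (rule dependent_nat_choice)
    show "\<exists>X. X \<in> H_of \<A> \<and> almost_below X X0" using X0 almost_below_refl by blast
  next
    fix X n assume X: "X \<in> H_of \<A> \<and> almost_below X X0"
    then obtain Y where Y: "Y \<in> H_of \<A>" "almost_below Y X" "P (enum n) Y" using dense by blast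
    then have "almost_below Y X0" using X almost_below_trans by blast
    then show "\<exists>Y. (Y \<in> H_of \<A> \<and> almost_below Y X0) \<and> almost_below Y X \<and> P (enum n) Y"
      using Y by blast
  qed
  then obtain Xs where Xs: "\<And>n. Xs n \<in> H_of \<A>" "\<And>n. almost_below (Xs n) X0"
    "\<And>n. almost_below (Xs (Suc n)) (Xs n)" "\<And>n. P (enum n) (Xs (Suc n))" by blast
  obtain X where X: "X \<in> H_of \<A>" "\<And>n. almost_below X (Xs n)"
    using H_of_sigma_closed[where Xs = Xs, OF mad Xs(3,1)] by blast
  have "almost_below X X0" using X(2) Xs(2) by (rule almost_below_trans)
  moreover have "P (enum n) X" for n using mono[OF Xs(4) X(2)] .
  then have "P i X" for i using enum by (metis UNIV_I rangeE)
  ultimately show ?thesis using X(1) by blast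
qed

section \<open>Negligible cells\<close>

definition cell :: "((nat \<Rightarrow> nat) \<Rightarrow> 'e set \<Rightarrow> bool) \<Rightarrow> nat list \<Rightarrow> 'e list \<Rightarrow> 'e set set" where
  "cell R s vs = {A. (\<exists>a. R a A \<and> map a [0..<length s] = s) \<and> set vs \<subseteq> A}"

definition negligible :: "((nat \<Rightarrow> nat) \<Rightarrow> 'e set \<Rightarrow> bool) \<Rightarrow> nat list \<times> 'e list \<Rightarrow> (nat \<Rightarrow> 'e) \<Rightarrow> bool"
  where "negligible R p X \<longleftrightarrow> (\<forall>A \<in> cell R (fst p) (snd p). finite_dim (seq_span X \<inter> A))"

lemma negligible_mono:
  assumes "negligible R p X" "almost_below Y X" "\<And>a A. R a A \<Longrightarrow> subspace A"
  shows "negligible R p Y"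
  using assms infinite_dim_almost_below unfolding negligible_def cell_def by blast

lemma countable_positions: "countable (UNIV :: (nat list \<times> 'e list) set)"
proof -
  have "countable (lists (UNIV :: nat set) \<times> lists (UNIV :: 'e set))"
    by (intro countable_SIGMA countable_lists countable_vectors) simp
  then show ?thesis by (simp add: lists_UNIV)
qed

section \<open>Deciding and extending cells\<close>

text \<open>If some element of \<open>H_of \<A>\<close> almost below makes the cell negligible, pass
  to it; otherwise the second alternative already holds. Both alternatives are inherited, so fusion
  handles all cells together.\<close>

lemma H_of_decides:
  assumes mad: "mad_family \<A>" and "infinite \<A>" and sub: "\<And>a A. R a A \<Longrightarrow> subspace A"
  shows "\<exists>X\<in>H_of \<A>. \<forall>p. negligible R p X \<or>
    (\<forall>Y\<in>H_of \<A>. almost_below Y X \<longrightarrow> \<not> negligible R p Y)"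
proof -
  define P where "P p X \<longleftrightarrow> negligible R p X \<or>
    (\<forall>Y\<in>H_of \<A>. almost_below Y X \<longrightarrow> \<not> negligible R p Y)" for p X
  obtain X0 where X0: "X0 \<in> H_of \<A>" using H_of_nonempty[OF mad] assms(2) by blast
  have "\<exists>X\<in>H_of \<A>. almost_below X X0 \<and> (\<forall>p. P p X)"
  proof (rule H_of_fusion[OF mad X0 countable_positions])
    show "\<exists>Y'\<in>H_of \<A>. almost_below Y' Y \<and> P p Y'" if "Y \<in> H_of \<A>" for p Y
      using that almost_below_refl unfolding P_def by blast
  next
    fix p Y Y' assume PY: "P p Y" and below: "almost_below Y' Y"
    show "P p Y'"
    proof (cases "negligible R p Y")
      case True
      then have "negligible R p Y'" using below sub by (rule negligible_mono)
      then show ?thesis by (simp add: P_def)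
    next
      case False
      then have "\<not> negligible R p Z" if "Z \<in> H_of \<A>" "almost_below Z Y'" for Z
        using PY that(1) almost_below_trans[OF that(2) below] unfolding P_def by blast
      then show ?thesis by (simp add: P_def)
    qed
  qed
  then show ?thesis unfolding P_def by blast
qed

text \<open>Discarding finitely many terms turns almost inclusion into true inclusion.\<close>

lemma preceq_shift:
  assumes "Z \<in> bb" "Z \<preceq> Y'" "almost_below Y' Y"
  shows "\<exists>N. (\<lambda>n. Z (n + N)) \<preceq> Y"
proof -
  obtain N where N: "seq_span Y' \<inter> deep_space N \<subseteq> seq_span Y"
    using assms(3) almost_below_def by blast
  have "Z (n + N) \<in> seq_span Y" for n
  proof -
    have "Z (n + N) \<in> deep_space N"
      using bb_deep[OF assms(1), of "n + N"] deep_space_mono[of N "n + N"] by auto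
    then show ?thesis using N assms(2) in_seq_span[of Z "n + N"] unfolding preceq_def by blast
  qed
  then show ?thesis
    unfolding preceq_def using seq_span_minimal[OF _ subspace_seq_span, of "\<lambda>n. Z (n + _)"] by blast
qed

lemma seq_span_shift: "seq_span (\<lambda>n. Z (n + N)) \<subseteq> seq_span Z"
  by (intro seq_span_minimal subspace_seq_span in_seq_span)

text \<open>Negligibility is tested at the fixed \<open>X1\<close> throughout: as \<open>X1\<close>
  decides every cell, non-negligibility there passes to all elements of \<open>H_of \<A>\<close>
  almost below it.\<close>

lemma H_of_extendable:
  assumes mad: "mad_family \<A>" and full: "full (H_of \<A>)"
    and sub: "\<And>a A. R a A \<Longrightarrow> subspace A"
    and X1: "X1 \<in> H_of \<A>"
    and decided: "\<And>p. negligible R p X1 \<or>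
      (\<forall>Y\<in>H_of \<A>. almost_below Y X1 \<longrightarrow> \<not> negligible R p Y)"
  shows "\<exists>X\<in>H_of \<A>. almost_below X X1 \<and> (\<forall>s vs. \<not> negligible R (s, vs) X1 \<longrightarrow>
    (\<forall>Z\<in>bb. Z \<preceq> X \<longrightarrow> (\<exists>v\<in>seq_span Z. v \<noteq> 0 \<and> (\<exists>i. \<not> negligible R (s @ [i], vs @ [v]) X1))))"
proof -
  \<comment> \<open>The zero vector belongs to every span, so it is put into \<open>D p\<close> by
    hand; a vector outside \<open>D p\<close> is then automatically nonzero.\<close>
  define D where "D p = {v. v = 0 \<or> (\<forall>i. negligible R (fst p @ [i], snd p @ [v]) X1)}" for p
  define P where "P p X \<longleftrightarrow> negligible R p X1 \<or> (\<forall>Z\<in>bb. Z \<preceq> X \<longrightarrow> \<not> seq_span Z \<subseteq> D p)"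
    for p X
  have "\<exists>X\<in>H_of \<A>. almost_below X X1 \<and> (\<forall>p. P p X)"
  proof (rule H_of_fusion[OF mad X1 countable_positions])
    fix p Y assume Y: "Y \<in> H_of \<A>" "almost_below Y X1"
    show "\<exists>Y'\<in>H_of \<A>. almost_below Y' Y \<and> P p Y'"
    proof (rule ccontr)
      assume no: "\<not> ?thesis"
      then have nn: "\<not> negligible R p X1"
        using Y(1) almost_below_refl unfolding P_def by blast
      \<comment> \<open>Failure of \<open>P p\<close> everywhere below \<open>Y\<close> supplies the
        hypothesis of fullness for \<open>D p\<close>, which then gives a \<open>Z\<close> in
        \<open>H_of \<A>\<close> itself.\<close>
      have "\<forall>Y' \<in> restrict_below (H_of \<A>) Y. \<exists>Z\<in>bb. Z \<preceq> Y' \<and> seq_span Z \<subseteq> D p"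
        using no preceq_almost_below unfolding P_def restrict_below_def by blast
      then obtain Z where Z: "Z \<in> H_of \<A>" "Z \<preceq> Y" "seq_span Z \<subseteq> D p"
        using full Y(1) unfolding full_def restrict_below_def by blast
      have ZX1: "almost_below Z X1"
        using preceq_almost_below[OF Z(2)] Y(2) by (rule almost_below_trans)
      then have "\<not> negligible R p Z" using decided nn Z(1) by blast
      then obtain A a where A: "R a A" "map a [0..<length (fst p)] = fst p" "set (snd p) \<subseteq> A"
        "\<not> finite_dim (seq_span Z \<inter> A)" unfolding negligible_def cell_def by blast
      obtain v where v: "v \<noteq> 0" "v \<in> seq_span Z" "v \<in> A"
        using infinite_dimD[OF A(4)] subspace_inter[OF subspace_seq_span sub[OF A(1)]] by blast
      \<comment> \<open>The code \<open>a\<close> of \<open>A\<close> supplies the next entry, so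
        \<open>A\<close> lies in a one-step extension by a nonzero \<open>v\<close> of
        \<open>D p\<close>, and such cells are negligible at \<open>X1\<close>.\<close>
      have "A \<in> cell R (fst p @ [a (length (fst p))]) (snd p @ [v])"
        using A v(3) by (auto simp: cell_def)
      moreover have "negligible R (fst p @ [a (length (fst p))], snd p @ [v]) X1"
        using v(1,2) Z(3) unfolding D_def by blast
      ultimately have "finite_dim (seq_span X1 \<inter> A)" by (simp add: negligible_def)
      then show False using infinite_dim_almost_below[OF ZX1 sub[OF A(1)] A(4)] by blast
    qed
  next
    fix p Y Y' assume PY: "P p Y" and below: "almost_below Y' Y"
    \<comment> \<open>Such a \<open>Z\<close> is only almost below \<open>Y\<close>, so a tail of it
      is tested instead; if the span of \<open>Z\<close> were inside \<open>D p\<close>, so would be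
      that of the tail.\<close>
    have "\<not> seq_span Z \<subseteq> D p" if "\<not> negligible R p X1" "Z \<in> bb" "Z \<preceq> Y'" for Z
      using preceq_shift[OF that(2,3) below] PY that(1) bb_shift[OF that(2)] seq_span_shift[of Z]
      unfolding P_def by blast
    then show "P p Y'" unfolding P_def by blast
  qed
  then obtain X where X: "X \<in> H_of \<A>" "almost_below X X1" "\<And>p. P p X" by blast
  have ext: "\<exists>v\<in>seq_span Z. v \<noteq> 0 \<and> (\<exists>i. \<not> negligible R (s @ [i], vs @ [v]) X1)"
    if "\<not> negligible R (s, vs) X1" "Z \<in> bb" "Z \<preceq> X" for s vs Z
  proof -
    have "\<not> seq_span Z \<subseteq> D (s, vs)" using X(3)[of "(s, vs)"] that unfolding P_def by blast
    then obtain v where "v \<in> seq_span Z" "v \<notin> D (s, vs)" by blast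
    then show ?thesis by (auto simp: D_def)
  qed
  show ?thesis by (intro bexI[OF _ X(1)] conjI X(2) allI impI ballI ext)
qed

section \<open>A branch through the non-negligible cells\<close>

text \<open>Members of the family need not be spanned by block sequences, whereas
  \<open>H_of_extendable\<close> extends cells only along such sequences.\<close>

lemma infinite_dim_block_sequence:
  assumes "subspace S" "\<not> finite_dim S"
  shows "\<exists>Z\<in>bb. seq_span Z \<subseteq> S"
proof -
  have "\<exists>Z\<in>bb. \<forall>n. Z n \<in> S"
    by (rule ex_block_sequence) (use infinite_dimD[OF assms(2,1)] in blast)
  then show ?thesis using seq_span_minimal[OF _ assms(1)] by blast
qed

lemma no_analytic_full_mad_family:
  assumes "full_mad_family \<A>" and "analytic_family \<A>"
  shows False
proof -
  have inf: "infinite \<A>" and mad: "mad_family \<A>" and full: "full (H_of \<A>)"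
    using assms(1) by (auto simp: full_mad_family_def)
  obtain R :: "(nat \<Rightarrow> nat) \<Rightarrow> 'e set \<Rightarrow> bool"
    where R: "\<forall>A. A \<in> \<A> \<longleftrightarrow> (\<exists>a. R a A)"
    and closed: "\<forall>as a As. (\<forall>k. R (as k) (As k)) \<longrightarrow>
      (\<forall>i. \<forall>\<^sub>F k in sequentially. as k i = a i) \<longrightarrow>
      (\<exists>A. R a A \<and> (\<forall>v. \<forall>\<^sub>F k in sequentially. v \<in> As k \<longleftrightarrow> v \<in> A))"
    using analytic_family_parametrization[OF assms(2)] by (elim exE conjE) (rule that)
  have sub: "subspace A" if "R a A" for a A using that R mad_family_subspace[OF mad] by blast
  obtain X1 where X1: "X1 \<in> H_of \<A>" and decided: "\<forall>p. negligible R p X1 \<or>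
      (\<forall>Y\<in>H_of \<A>. almost_below Y X1 \<longrightarrow> \<not> negligible R p Y)"
    using H_of_decides[where R = R, OF mad inf sub] by (rule bexE)
  have "\<exists>X\<in>H_of \<A>. almost_below X X1 \<and> (\<forall>s vs. \<not> negligible R (s, vs) X1 \<longrightarrow>
    (\<forall>Z\<in>bb. Z \<preceq> X \<longrightarrow> (\<exists>v\<in>seq_span Z. v \<noteq> 0 \<and> (\<exists>i. \<not> negligible R (s @ [i], vs @ [v]) X1))))"
    by (rule H_of_extendable[OF mad full sub X1 decided[rule_format]])
  then obtain X where X: "X \<in> H_of \<A>"
    and ext: "\<And>s vs Z. \<not> negligible R (s, vs) X1 \<Longrightarrow> Z \<in> bb \<Longrightarrow> Z \<preceq> X \<Longrightarrow>
      \<exists>v\<in>seq_span Z. v \<noteq> 0 \<and> (\<exists>i. \<not> negligible R (s @ [i], vs @ [v]) X1)"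
    by meson
  have infX: "infinite {Y \<in> \<A>. \<not> finite_dim (seq_span X \<inter> Y)}"
    using X by (simp add: H_of_def)
  obtain A0 where A0: "A0 \<in> \<A>" "\<not> finite_dim (seq_span X \<inter> A0)"
    using infinite_imp_nonempty[OF infX] by blast
  obtain A1 where A1: "A1 \<in> \<A>" "\<not> finite_dim (seq_span X \<inter> A1)" "A1 \<noteq> A0"
    using infinite_imp_nonempty[OF infinite_remove[OF infX, of A0]] by blast
  define target where "target n = (if even n then A0 else A1)" for n :: nat
  have target: "target n \<in> \<A>" "\<not> finite_dim (seq_span X \<inter> target n)" for n
    using A0 A1 by (auto simp: target_def)
  have "\<exists>f. \<forall>n. (\<not> negligible R (f n) X1 \<and> (n = 0 \<longrightarrow> f n = ([], []))) \<and>
    (\<exists>i v. f (Suc n) = (fst (f n) @ [i], snd (f n) @ [v]) \<and>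
      v \<noteq> 0 \<and> v \<in> deep_space n \<and> v \<in> target n)"
  proof (rule dependent_nat_choice)
    have "infinite {Y \<in> \<A>. \<not> finite_dim (seq_span X1 \<inter> Y)}" using X1 by (simp add: H_of_def)
    then obtain A where "A \<in> \<A>" "\<not> finite_dim (seq_span X1 \<inter> A)"
      using infinite_imp_nonempty by blast
    then have "\<not> negligible R ([], []) X1" using R by (auto simp: negligible_def cell_def)
    then show "\<exists>p. \<not> negligible R p X1 \<and> (0 = (0::nat) \<longrightarrow> p = ([], []))" by blast
  next
    fix p n assume "\<not> negligible R p X1 \<and> (n = (0::nat) \<longrightarrow> p = ([], []))"
    then have p: "\<not> negligible R (fst p, snd p) X1" by simp
    \<comment> \<open>The factor \<open>deep_space n\<close> pushes the chosen vectors ever deeper,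
      so that those taken in \<open>A0\<close>, and likewise those taken in \<open>A1\<close>,
      witness infinite dimension.\<close>
    let ?S = "seq_span X \<inter> target n \<inter> deep_space n"
    have "subspace (seq_span X \<inter> target n)"
      by (intro subspace_inter subspace_seq_span mad_family_subspace[OF mad] target(1))
    then have "subspace ?S" "\<not> finite_dim ?S"
      using infinite_dim_Int_deep target(2) by (auto intro: subspace_inter subspace_deep)
    then obtain Z where Z: "Z \<in> bb" "seq_span Z \<subseteq> ?S"
      using infinite_dim_block_sequence by blast
    then have "Z \<preceq> X" by (auto simp: preceq_def)
    then obtain v i where "v \<in> seq_span Z" "v \<noteq> 0" "\<not> negligible R (fst p @ [i], snd p @ [v]) X1"
      using ext[OF p Z(1)] by blast
    then show "\<exists>q. (\<not> negligible R q X1 \<and> (Suc n = 0 \<longrightarrow> q = ([], []))) \<and>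
        (\<exists>i v. q = (fst p @ [i], snd p @ [v]) \<and> v \<noteq> 0 \<and> v \<in> deep_space n \<and> v \<in> target n)"
      using Z(2) by blast
  qed
  then obtain f where f: "\<And>n. \<not> negligible R (f n) X1" "f 0 = ([], [])"
    and step: "\<And>n. \<exists>i v. f (Suc n) = (fst (f n) @ [i], snd (f n) @ [v]) \<and>
      v \<noteq> 0 \<and> v \<in> deep_space n \<and> v \<in> target n" by blast
  obtain a v where av: "\<And>n. f (Suc n) = (fst (f n) @ [a n], snd (f n) @ [v n])"
    and v: "\<And>n. v n \<noteq> 0" "\<And>n. v n \<in> deep_space n" "\<And>n. v n \<in> target n"
    using step by metis
  have fn: "f n = (map a [0..<n], map v [0..<n])" for n
    by (induction n) (simp_all add: f(2) av)
  \<comment> \<open>A non-negligible cell is nonempty: at each stage some member contains the first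
    \<open>n\<close> vectors and has a code agreeing with \<open>a\<close> below
    \<open>n\<close>.\<close>
  have "\<exists>b A. R b A \<and> (\<forall>i<n. b i = a i) \<and> (\<forall>k<n. v k \<in> A)" for n
  proof -
    obtain A where "A \<in> cell R (map a [0..<n]) (map v [0..<n])"
      using f(1)[of n] by (auto simp: negligible_def fn)
    then obtain b where "R b A" "map b [0..<n] = map a [0..<n]" "v ` {0..<n} \<subseteq> A"
      by (auto simp: cell_def)
    then show ?thesis by (intro exI[of _ b] exI[of _ A]) (auto simp: image_subset_iff)
  qed
  then obtain as As where as: "\<And>n. R (as n) (As n)" "\<And>n i. i < n \<Longrightarrow> as n i = a i"
    "\<And>n k. k < n \<Longrightarrow> v k \<in> As n" by metis
  have "\<forall>\<^sub>F n in sequentially. as n i = a i" for i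
    using eventually_gt_at_top[of i] by eventually_elim (rule as(2))
  then obtain A where A: "R a A" "\<And>w. \<forall>\<^sub>F n in sequentially. w \<in> As n \<longleftrightarrow> w \<in> A"
    using closed as(1) by blast
  have vA: "v k \<in> A" for k
  proof -
    have "\<forall>\<^sub>F n in sequentially. v k \<in> A"
      using A(2)[of "v k"] eventually_gt_at_top[of k] by eventually_elim (use as(3) in blast)
    then show ?thesis by simp
  qed
  have "A \<in> \<A>" using A(1) R by blast
  \<comment> \<open>The limit \<open>A\<close> shares nonzero vectors of arbitrary depth with every
    member that is targeted infinitely often, hence equals it; this applies to both
    \<open>A0\<close> and \<open>A1\<close>.\<close>
  have "A = B" if B: "B \<in> \<A>" and often: "\<And>N. \<exists>n\<ge>N. target n = B" for B
  proof (rule mad_family_eqI[OF mad \<open>A \<in> \<A>\<close> B], rule infinite_dimI)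
    show "subspace (A \<inter> B)"
      using mad_family_subspace[OF mad] \<open>A \<in> \<A>\<close> B by (intro subspace_inter)
    fix N
    obtain n where "n \<ge> N" "target n = B" using often by blast
    then show "\<exists>x. x \<noteq> 0 \<and> x \<in> deep_space N \<and> x \<in> A \<inter> B"
      using v[of n] vA[of n] deep_space_mono[of N n] by blast
  qed
  moreover have "\<exists>n\<ge>N. target n = A0" for N
    by (rule exI[of _ "2 * N"]) (simp add: target_def)
  moreover have "\<exists>n\<ge>N. target n = A1" for N
    by (rule exI[of _ "2 * N + 1"]) (simp add: target_def)
  ultimately show False using A0(1) A1(1,3) by metis
qed

end

theorem theorem4p10:
  fixes scale :: "'f::field \<Rightarrow> 'e::ab_group_add \<Rightarrow> 'e"
    and e :: "nat \<Rightarrow> 'e"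
  assumes "based_vector_space scale e"
  shows "\<not> (\<exists>\<A> :: 'e set set.
           based_vector_space.full_mad_family scale e \<A> \<and> analytic_family \<A>)"
  using based_vector_space.no_analytic_full_mad_family[OF assms] by blast

end
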